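(* Let $d\ge 1$, let $M\ge 1$, and let $\pi$ and $\eta$ be probability distributions on $\mathbb{R}^d$ supported on the Euclidean ball $B_2(M)=\{x\in\mathbb{R}^d:\|x\|_2\le M\}$. Then $$\mathrm{KL}(f_\pi\|f_\eta)\le 200M^2H^2(f_\pi,f_\eta)+16H^2(f_\pi,f_\eta)\log\frac{1}{H^2(f_\pi,f_\eta)}.$$
   Context: For a probability distribution $\pi$ on $\mathbb{R}^d$, $f_\pi=\pi*\varphi$ denotes the Gaussian mixture density $f_\pi(x)=\int_{\mathbb{R}^d}\varphi(x-z)\,\pi(dz)$, where $\varphi(z)=(2\pi)^{-d/2}\exp(-\|z\|_2^2/2)$ is the density of $\mathcal{N}(0,I_d)$. For densities $f,g$: $\mathrm{KL}(f\|g)=\int f\log\frac{f}{g}$ (natural logarithm) and $H^2(f,g)=\int(\sqrt f-\sqrt g)^2$. Convention: $0\cdot\log\frac10=0$. *)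

theory Defs
  imports "HOL-Probability.Probability"
begin

text \<open>The space \<open>\<real>\<^sup>d\<close> is \<^typ>\<open>real ^ 'n\<close> with \<open>d = CARD('n)\<close>; index types are nonempty, so \<open>d \<ge> 1\<close>.\<close>

definition std_gaussian_density :: "real ^ 'n \<Rightarrow> real" where
  "std_gaussian_density z =
     (2 * pi) powr (- real CARD('n) / 2) * exp (- (norm z)\<^sup>2 / 2)"

definition gaussian_mixture :: "(real ^ 'n) measure \<Rightarrow> real ^ 'n \<Rightarrow> real" where
  "gaussian_mixture P x = (LINT z|P. std_gaussian_density (x - z))"

definition prob_dist_on :: "(real ^ 'n) set \<Rightarrow> (real ^ 'n) measure \<Rightarrow> bool" where
  "prob_dist_on S P \<longleftrightarrow> prob_space P \<and> sets P = sets borel \<and> (AE z in P. z \<in> S)"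

text \<open>
  The Bochner integral is 0 by convention when the integrand is not integrable, so a bound on \<open>kl_density\<close>
  is meaningful only together with \<open>kl_integrable\<close>. The convention \<open>0 * ln (0 / g) = 0\<close> holds
  automatically.
\<close>

definition kl_integrable :: "(real ^ 'n \<Rightarrow> real) \<Rightarrow> (real ^ 'n \<Rightarrow> real) \<Rightarrow> bool" where
  "kl_integrable f g \<longleftrightarrow> integrable lborel (\<lambda>x. f x * ln (f x / g x))"

definition kl_density :: "(real ^ 'n \<Rightarrow> real) \<Rightarrow> (real ^ 'n \<Rightarrow> real) \<Rightarrow> real" where
  "kl_density f g = (LINT x|lborel. f x * ln (f x / g x))"

definition hellinger_sq :: "(real ^ 'n \<Rightarrow> real) \<Rightarrow> (real ^ 'n \<Rightarrow> real) \<Rightarrow> real" where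
  "hellinger_sq f g = (LINT x|lborel. (sqrt (f x) - sqrt (g x))\<^sup>2)"

text \<open>The library's divergence takes the reference measure first.\<close>

lemma kl_density_eq_KL_divergence:
  assumes "f \<in> borel_measurable borel" "g \<in> borel_measurable borel"
    and "\<And>x. f x \<ge> 0" "\<And>x. g x > 0"
  shows "kl_density f g =
    KL_divergence (exp 1) (density lborel (\<lambda>x. ennreal (g x))) (density lborel (\<lambda>x. ennreal (f x)))"
proof -
  have "KL_divergence (exp 1) (density lborel (\<lambda>x. ennreal (g x))) (density lborel (\<lambda>x. ennreal (f x)))
      = (LINT x|lborel. f x * log (exp 1) (f x / g x))"
    using assms(1-3) assms(4)[THEN less_imp_le] assms(4)[THEN order.strict_implies_not_eq]
    by (intro lborel.KL_density_density) auto
  then show ?thesis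
    by (simp add: kl_density_def log_def)
qed

end

theory Submission
  imports Defs
begin

text \<open>
  Write \<open>f\<close> and \<open>g\<close> for the two mixture densities and \<open>r = f / g\<close>. Since both integrate to \<open>1\<close>,
  the relative entropy is \<open>\<integral> g (r ln r - r + 1)\<close>, and the squared Hellinger distance \<open>H\<close> is
  \<open>\<integral> g (\<surd>r - 1)\<^sup>2\<close>. The two integrands are comparable near \<open>r = 1\<close>; for large \<open>r\<close>
  their ratio grows like \<open>ln r\<close>. Truncate at a level \<open>K\<close>: where \<open>r \<le> K\<close> the ratio is at most
  a multiple of \<open>ln K\<close>, and where \<open>r > K \<ge> exp 1\<close> one has \<open>r ln r \<le> r\<^sup>2 ln K / K\<close>, so that this part is
  paid for by the second moment \<open>\<integral> f\<^sup>2 / g\<close>. This is the pointwise inequality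
  \<open>kl_integrand_le_hellinger_plus_chi_square\<close>.

  If \<open>\<integral> f\<^sup>2 / g \<le> exp D\<close>, then the choice \<open>K = exp D / H\<close> makes the tail contribute
  \<open>H ln K\<close>, and the total is \<open>5 H (D + ln (1 / H))\<close>
  (\<open>kl_le_hellinger_of_chi_square_le\<close>).

  The dimension does not enter because \<open>D\<close> does not depend on it. A pointwise bound on \<open>f / g\<close> would
  involve \<open>norm x\<close>, which is typically of the order of the square root of the dimension. Instead,
  \<open>(u, v) \<mapsto> u\<^sup>2 / v\<close> is jointly convex, so \<open>\<integral> f\<^sup>2 / g\<close> is at most the average, over pairs of
  centres \<open>a\<close> and \<open>b\<close>, of its value for two shifted Gaussians. That value is \<open>exp ((norm (a - b))\<^sup>2)\<close>,
  at most \<open>exp (4 M\<^sup>2)\<close> for centres in the ball of radius \<open>M\<close>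
  (\<open>gaussian_mixture_chi_square_le\<close>). With \<open>D = 4 M\<^sup>2\<close> this gives
  \<open>20 M\<^sup>2 H + 5 H ln (1 / H)\<close>. The logarithm may be negative, but \<open>H \<le> 2\<close> keeps it above \<open>-1\<close>,
  so raising its coefficient to \<open>16\<close> costs at most \<open>11 H\<close>, which the larger multiple of \<open>M\<^sup>2 H\<close>
  absorbs.
\<close>

section \<open>Comparing the integrands of the two divergences\<close>

text \<open>
  Monotonicity of \<open>x \<mapsto> ln x / x\<close> to the right of \<open>exp 1\<close>, hence a tail bound for \<open>ln\<close>:
  beyond \<open>K\<close> its graph stays below the line through the origin and \<open>(K, ln K)\<close>.
\<close>

lemma ln_le_line_through_origin:
  fixes r K :: real
  assumes "0 < K" "1 \<le> ln K" "K \<le> r"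
  shows "ln r \<le> r * ln K / K"
proof -
  have "ln (r / K) \<le> r / K - 1"
    using assms by (intro ln_le_minus_one) auto
  also have "\<dots> \<le> ln K * (r / K - 1)"
    using assms mult_right_mono[of 1 "ln K" "r / K - 1"] by (simp add: field_simps)
  finally have "ln r - ln K \<le> ln K * (r / K - 1)"
    using assms by (simp add: ln_div)
  then show ?thesis
    by (simp add: algebra_simps)
qed

text \<open>
  With \<open>s = \<surd>r\<close>, the bound \<open>ln s \<le> s - 1\<close> bounds the left-hand side by
  \<open>(2 s + 1) (s - 1)\<^sup>2\<close>, which has the same double zero at \<open>s = 1\<close> as the Hellinger integrand;
  this settles \<open>s \<le> 2\<close>. For \<open>s > 2\<close> the term \<open>r ln r\<close> dominates: below the level \<open>K\<close>
  it is controlled through \<open>s \<le> 2 (s - 1)\<close>, above it by the quadratic term. The threshold \<open>5 / 4\<close>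
  makes \<open>4 ln K\<close> at least \<open>2 s + 1\<close> for all \<open>s \<le> 2\<close>.
\<close>

lemma kl_integrand_le_hellinger_plus_chi_square:
  fixes r K :: real
  assumes "0 \<le> r" "0 < K" and L: "5 / 4 \<le> ln K"
  shows "r * ln r - r + 1 \<le> 4 * ln K * (sqrt r - 1)\<^sup>2 + r\<^sup>2 * ln K / K"
proof -
  have tail_nonneg: "0 \<le> r\<^sup>2 * ln K / K"
    using assms(2) L by (intro divide_nonneg_pos mult_nonneg_nonneg) (simp, linarith)
  have hell_nonneg: "0 \<le> 4 * ln K * (sqrt r - 1)\<^sup>2"
    using L by (intro mult_nonneg_nonneg) auto
  show ?thesis
  proof (cases "r = 0")
    case True
    then show ?thesis using L by simp
  next
    case False
    then have r: "0 < r" using assms by simp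
    define s where "s = sqrt r"
    have s: "0 < s" "r = s\<^sup>2" using r by (auto simp: s_def)
    consider "s \<le> 2" | "2 < s" "r \<le> K" | "2 < s" "K < r" by linarith
    then show ?thesis
    proof cases
      case 1
      have "r * ln r - r + 1 = 2 * s\<^sup>2 * ln s - s\<^sup>2 + 1"
        using s by (simp add: ln_realpow)
      also have "\<dots> \<le> 2 * s\<^sup>2 * (s - 1) - s\<^sup>2 + 1"
        using s ln_le_minus_one[of s] by (simp add: mult_left_mono)
      also have "\<dots> = (2 * s + 1) * (s - 1)\<^sup>2"
        by (simp add: power2_eq_square algebra_simps)
      also have "\<dots> \<le> 4 * ln K * (s - 1)\<^sup>2"
        using 1 L by (intro mult_right_mono) auto
      finally show ?thesis using tail_nonneg by (simp add: s_def)
    next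
      case 2
      have "4 < r" using 2 power_strict_mono[of 2 s 2] s by simp
      moreover have "r * ln r \<le> r * ln K"
        using 2 r assms(2) by (intro mult_left_mono) auto
      ultimately have "r * ln r - r + 1 \<le> s\<^sup>2 * ln K"
        by (subst s(2)[symmetric]) linarith
      also have "\<dots> \<le> (2 * (s - 1))\<^sup>2 * ln K"
        using 2 L s by (intro mult_right_mono power_mono) auto
      also have "\<dots> = 4 * ln K * (s - 1)\<^sup>2"
        by (subst power_mult_distrib) simp
      finally show ?thesis using tail_nonneg by (simp add: s_def)
    next
      case 3
      have "4 < r" using 3 power_strict_mono[of 2 s 2] s by simp
      then have "r * ln r - r + 1 \<le> r * ln r" by simp
      also have "\<dots> \<le> r * (r * ln K / K)"
        using 3 assms r by (intro mult_left_mono ln_le_line_through_origin) auto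
      finally show ?thesis using hell_nonneg by (simp add: power2_eq_square)
    qed
  qed
qed

section \<open>Relative entropy from Hellinger distance and chi-square divergence\<close>

text \<open>
  Supplies a dominating function for the integrand of the relative entropy. Both signs come from
  \<open>ln y \<le> y - 1\<close>, applied to \<open>r\<close> and to \<open>1 / r\<close>.
\<close>

lemma abs_mult_ln_le:
  fixes r :: real
  assumes "0 \<le> r"
  shows "\<bar>r * ln r\<bar> \<le> r\<^sup>2 + 1"
proof (cases "r = 0")
  case False
  then have r: "0 < r" using assms by simp
  have "r * ln r \<le> r * (r - 1)"
    using r by (intro mult_left_mono ln_le_minus_one) auto
  moreover have "r * (1 - 1 / r) \<le> r * ln r"
    using r ln_le_minus_one[of "1 / r"] by (intro mult_left_mono) (auto simp: ln_div)
  moreover have "0 \<le> r * r" by simp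
  moreover have "r * (r - 1) = r * r - r" "r * (1 - 1 / r) = r - 1"
    using r by (auto simp: algebra_simps)
  ultimately show ?thesis
    using r unfolding power2_eq_square abs_le_iff by linarith
qed simp

lemma kl_integrable_of_chi_square:
  assumes [measurable]: "f \<in> borel_measurable N"
    and g: "integrable N g"
    and fg: "integrable N (\<lambda>x. (f x)\<^sup>2 / g x)"
    and "\<And>x. 0 \<le> f x" "\<And>x. 0 < g x"
  shows "integrable N (\<lambda>x. f x * ln (f x / g x) :: real)"
proof (rule Bochner_Integration.integrable_bound)
  show "integrable N (\<lambda>x. (f x)\<^sup>2 / g x + g x)"
    using g fg by simp
  have [measurable]: "g \<in> borel_measurable N" using g by simp
  show "(\<lambda>x. f x * ln (f x / g x)) \<in> borel_measurable N" by measurable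
  show "AE x in N. norm (f x * ln (f x / g x)) \<le> norm ((f x)\<^sup>2 / g x + g x)"
  proof (rule AE_I2)
    fix x
    have "\<bar>f x * ln (f x / g x)\<bar> = g x * \<bar>f x / g x * ln (f x / g x)\<bar>"
      using assms(4,5)[of x] by (simp add: abs_mult)
    also have "\<dots> \<le> g x * ((f x / g x)\<^sup>2 + 1)"
      using assms(4,5)[of x] by (intro mult_left_mono abs_mult_ln_le) auto
    also have "\<dots> = (f x)\<^sup>2 / g x + g x"
      using assms(5)[of x] by (simp add: power2_eq_square field_simps)
    finally show "norm (f x * ln (f x / g x)) \<le> norm ((f x)\<^sup>2 / g x + g x)"
      by simp
  qed
qed

lemma hellinger_integrable:
  fixes f g :: "_ \<Rightarrow> real"
  assumes f: "integrable N f" and g: "integrable N g" and "\<And>x. 0 \<le> f x" "\<And>x. 0 \<le> g x"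
  shows "integrable N (\<lambda>x. (sqrt (f x) - sqrt (g x))\<^sup>2)"
    and "(LINT x|N. (sqrt (f x) - sqrt (g x))\<^sup>2) \<le> (LINT x|N. f x) + (LINT x|N. g x)"
proof -
  have [measurable]: "f \<in> borel_measurable N" "g \<in> borel_measurable N" using f g by auto
  have le: "(sqrt (f x) - sqrt (g x))\<^sup>2 \<le> f x + g x" for x
    using assms(3,4)[of x] by (simp add: power2_diff)
  show int: "integrable N (\<lambda>x. (sqrt (f x) - sqrt (g x))\<^sup>2)"
    by (rule Bochner_Integration.integrable_bound[of _ "\<lambda>x. f x + g x"])
      (use f g le assms(3,4) in \<open>auto simp: abs_of_nonneg add_nonneg_nonneg\<close>)
  have "(LINT x|N. (sqrt (f x) - sqrt (g x))\<^sup>2) \<le> (LINT x|N. f x + g x)"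
    using f g le by (intro integral_mono int) auto
  then show "(LINT x|N. (sqrt (f x) - sqrt (g x))\<^sup>2) \<le> (LINT x|N. f x) + (LINT x|N. g x)"
    using f g by simp
qed

text \<open>
  Equality of the masses allows \<open>g - f\<close> to be added to the integrand for free; only this corrected
  integrand vanishes to second order at \<open>f = g\<close>, as a comparison with the Hellinger integrand
  requires.
\<close>

lemma kl_le_hellinger_plus_chi_square:
  fixes f g :: "_ \<Rightarrow> real"
  assumes f: "integrable N f" and g: "integrable N g"
    and fg: "integrable N (\<lambda>x. (f x)\<^sup>2 / g x)"
    and "\<And>x. 0 \<le> f x" "\<And>x. 0 < g x"
    and mass: "(LINT x|N. f x) = (LINT x|N. g x)"
    and K: "0 < K" "5 / 4 \<le> ln K"
  shows "(LINT x|N. f x * ln (f x / g x)) \<le>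
    4 * ln K * (LINT x|N. (sqrt (f x) - sqrt (g x))\<^sup>2) + ln K / K * (LINT x|N. (f x)\<^sup>2 / g x)"
proof -
  have kl: "integrable N (\<lambda>x. f x * ln (f x / g x))"
    using assms by (intro kl_integrable_of_chi_square) auto
  have hell: "integrable N (\<lambda>x. (sqrt (f x) - sqrt (g x))\<^sup>2)"
    using assms by (intro hellinger_integrable) (auto intro: less_imp_le)
  have ptw: "f x * ln (f x / g x) - f x + g x \<le>
    4 * ln K * (sqrt (f x) - sqrt (g x))\<^sup>2 + ln K / K * ((f x)\<^sup>2 / g x)" for x
  proof -
    define r where "r = f x / g x"
    have fx: "f x = g x * r" and r: "0 \<le> r"
      using assms(4,5)[of x] by (auto simp: r_def)
    have sq: "g x * (sqrt r - 1)\<^sup>2 = (sqrt (f x) - sqrt (g x))\<^sup>2"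
    proof -
      have "(sqrt (f x) - sqrt (g x))\<^sup>2 = (sqrt (g x) * (sqrt r - 1))\<^sup>2"
        by (simp add: fx real_sqrt_mult algebra_simps)
      then show ?thesis
        using assms(5)[of x] by (simp add: power_mult_distrib)
    qed
    have "f x * ln (f x / g x) - f x + g x = g x * (r * ln r - r + 1)"
      by (simp add: fx[symmetric] flip: r_def) (simp add: fx algebra_simps)
    also have "\<dots> \<le> g x * (4 * ln K * (sqrt r - 1)\<^sup>2 + r\<^sup>2 * ln K / K)"
      using assms(5)[of x] r K
      by (intro mult_left_mono kl_integrand_le_hellinger_plus_chi_square) auto
    also have "\<dots> = 4 * ln K * (g x * (sqrt r - 1)\<^sup>2) + ln K / K * ((f x)\<^sup>2 / g x)"
      using assms(5)[of x] by (simp add: r_def power2_eq_square field_simps)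
    finally show ?thesis by (simp add: sq)
  qed
  have "(LINT x|N. f x * ln (f x / g x)) = (LINT x|N. f x * ln (f x / g x) - f x + g x)"
    using kl f g mass by simp
  also have "\<dots> \<le> (LINT x|N. 4 * ln K * (sqrt (f x) - sqrt (g x))\<^sup>2 + ln K / K * ((f x)\<^sup>2 / g x))"
    by (intro integral_mono ptw Bochner_Integration.integrable_add Bochner_Integration.integrable_diff
        integrable_mult_right kl f g hell fg)
  also have "\<dots> = 4 * ln K * (LINT x|N. (sqrt (f x) - sqrt (g x))\<^sup>2) + ln K / K * (LINT x|N. (f x)\<^sup>2 / g x)"
    by (simp only: Bochner_Integration.integral_add integral_mult_right_zero
        integrable_mult_right hell fg)
  finally show ?thesis .
qed

text \<open>
  The level \<open>K = exp D / H\<close> balances the two terms of the preceding bound up to a constant factor. It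
  is admissible since \<open>H \<le> 2\<close> gives \<open>ln K \<ge> 2 - ln 2 > 5 / 4\<close>. For \<open>H = 0\<close> there is no such
  level, but then \<open>f = g\<close> almost everywhere and the relative entropy vanishes.
\<close>

lemma kl_le_hellinger_of_chi_square_le:
  fixes f g :: "_ \<Rightarrow> real"
  assumes f: "integrable N f" and g: "integrable N g"
    and fg: "integrable N (\<lambda>x. (f x)\<^sup>2 / g x)"
    and nonneg: "\<And>x. 0 \<le> f x" and pos: "\<And>x. 0 < g x"
    and mass: "(LINT x|N. f x) = 1" "(LINT x|N. g x) = 1"
    and chi: "(LINT x|N. (f x)\<^sup>2 / g x) \<le> exp D" and D: "2 \<le> D"
  defines "H \<equiv> (LINT x|N. (sqrt (f x) - sqrt (g x))\<^sup>2)"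
  shows "(LINT x|N. f x * ln (f x / g x)) \<le> 5 * H * (D + ln (1 / H))"
proof (cases "H = 0")
  case True
  have "AE x in N. (sqrt (f x) - sqrt (g x))\<^sup>2 = 0"
    using True hellinger_integrable(1)[OF f g nonneg less_imp_le[OF pos]]
    by (subst (asm) H_def, subst (asm) integral_nonneg_eq_0_iff_AE) auto
  then have "AE x in N. f x * ln (f x / g x) = 0"
    by eventually_elim (use pos in \<open>auto simp: less_imp_neq[THEN not_sym]\<close>)
  then have "(LINT x|N. f x * ln (f x / g x)) = 0"
    by (rule integral_eq_zero_AE)
  then show ?thesis using True by simp
next
  case False
  have "0 \<le> H" unfolding H_def by simp
  with False have H: "0 < H" by simp
  have "H \<le> 2"
    using hellinger_integrable(2)[OF f g nonneg less_imp_le[OF pos]] mass by (simp add: H_def)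
  then have "ln H \<le> ln 2" using H by simp
  also have "ln 2 < (3 / 4 :: real)"
    using ln2_le_25_over_36 by simp
  finally have "ln H < 3 / 4" .
  define K where "K = exp D / H"
  have K: "0 < K" using H by (simp add: K_def)
  have lnK: "ln K = D + ln (1 / H)" using H by (simp add: K_def ln_div)
  then have lnK_ge: "5 / 4 \<le> ln K"
    using \<open>ln H < 3 / 4\<close> D H by (simp add: ln_div)
  have "(LINT x|N. f x * ln (f x / g x)) \<le> 4 * ln K * H + ln K / K * (LINT x|N. (f x)\<^sup>2 / g x)"
    unfolding H_def using f g fg nonneg pos mass K lnK_ge
    by (intro kl_le_hellinger_plus_chi_square) auto
  also have "\<dots> \<le> 4 * ln K * H + ln K / K * exp D"
    using chi K lnK_ge by (intro add_left_mono mult_left_mono divide_nonneg_pos) linarith+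
  also have "\<dots> = 5 * H * ln K"
    using H by (simp add: K_def field_simps)
  finally show ?thesis by (simp add: lnK)
qed

section \<open>Gaussian densities\<close>

lemma std_gaussian_density_pos: "0 < std_gaussian_density z"
  by (simp add: std_gaussian_density_def)

lemma borel_measurable_std_gaussian_density [measurable]:
  "std_gaussian_density \<in> borel_measurable borel"
  unfolding std_gaussian_density_def by measurable

lemma std_gaussian_density_le: "std_gaussian_density (z :: real ^ 'n) \<le> std_gaussian_density (0 :: real ^ 'n)"
  by (simp add: std_gaussian_density_def)

lemma std_gaussian_density_eq_prod:
  "std_gaussian_density (x - c :: real ^ 'n) = (\<Prod>b\<in>Basis. normal_density (c \<bullet> b) 1 (x \<bullet> b))"
proof -
  have "(norm (x - c))\<^sup>2 = (\<Sum>b\<in>Basis. (x \<bullet> b - c \<bullet> b)\<^sup>2)"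
    unfolding power2_norm_eq_inner
    by (subst euclidean_inner) (simp add: inner_diff_left power2_eq_square)
  moreover have "(2 * pi) powr (- real CARD('n) / 2) = (1 / sqrt (2 * pi)) ^ CARD('n)"
  proof -
    have "1 / sqrt (2 * pi) = (2 * pi) powr (- 1 / 2)"
      by (simp add: powr_half_sqrt[symmetric] powr_minus_divide)
    then show ?thesis by (simp add: powr_power)
  qed
  ultimately show ?thesis
    by (simp add: std_gaussian_density_def normal_density_def prod_dividef exp_sum
        sum_negf[symmetric] sum_divide_distrib power_divide)
qed

lemma nn_integral_std_gaussian_density:
  "(\<integral>\<^sup>+x. ennreal (std_gaussian_density (x - c)) \<partial>lborel) = 1"
proof -
  have "(\<integral>\<^sup>+x. ennreal (std_gaussian_density (x - c)) \<partial>lborel)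
    = (\<integral>\<^sup>+x. (\<Prod>b\<in>Basis. ennreal (normal_density (c \<bullet> b) 1 (x \<bullet> b))) \<partial>lborel)"
    by (simp add: std_gaussian_density_eq_prod prod_ennreal)
  also have "\<dots> = (\<Prod>b\<in>Basis. \<integral>\<^sup>+x. ennreal (normal_density (c \<bullet> b) 1 x) \<partial>lborel)"
    by (rule nn_integral_lborel_prod) auto
  also have "\<dots> = 1"
    by (simp add: nn_integral_eq_integral)
  finally show ?thesis .
qed

text \<open>
  Completing the square: the quotient is again a Gaussian, centred at \<open>2 a - b\<close>, up to a factor that
  is therefore the second moment of the density ratio.
\<close>

lemma std_gaussian_density_square_quotient:
  "(std_gaussian_density (x - a))\<^sup>2 / std_gaussian_density (x - b)
    = exp ((norm (a - b))\<^sup>2) * std_gaussian_density (x - (2 *\<^sub>R a - b))"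
proof -
  have "2 * (- (norm (x - a))\<^sup>2 / 2) - (- (norm (x - b))\<^sup>2 / 2)
    = (norm (a - b))\<^sup>2 + - (norm (x - (2 *\<^sub>R a - b)))\<^sup>2 / 2"
    by (simp add: power2_norm_eq_inner inner_diff_left inner_diff_right
        inner_commute[of a x] inner_commute[of b x] inner_commute[of b a])
      (simp add: field_simps)
  then have "exp (- (norm (x - a))\<^sup>2 / 2) ^ 2 / exp (- (norm (x - b))\<^sup>2 / 2)
    = exp ((norm (a - b))\<^sup>2) * exp (- (norm (x - (2 *\<^sub>R a - b)))\<^sup>2 / 2)"
    by (simp only: exp_double[symmetric] exp_diff[symmetric] exp_add[symmetric])
  moreover have "(k * u)\<^sup>2 / (k * v) = k * (u\<^sup>2 / v)" for k u v :: real
    by (simp add: power2_eq_square)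
  ultimately show ?thesis
    unfolding std_gaussian_density_def by (simp only: mult.left_commute)
qed

section \<open>Gaussian mixtures\<close>

lemma integrable_std_gaussian_density_diff:
  assumes "prob_space P" "sets P = sets borel"
  shows "integrable P (\<lambda>z. std_gaussian_density (x - z :: real ^ 'n))"
proof -
  interpret prob_space P by fact
  have [measurable_cong]: "sets P = sets borel" by fact
  show ?thesis
    by (rule integrable_const_bound[where B = "std_gaussian_density 0"])
      (auto intro!: AE_I2 std_gaussian_density_le
        simp: less_imp_le[OF std_gaussian_density_pos])
qed

lemma gaussian_mixture_eq_nn_integral:
  assumes "prob_space P" "sets P = sets borel"
  shows "ennreal (gaussian_mixture P x) = (\<integral>\<^sup>+z. ennreal (std_gaussian_density (x - z)) \<partial>P)"
  unfolding gaussian_mixture_def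
  using integrable_std_gaussian_density_diff[OF assms] std_gaussian_density_pos
  by (subst nn_integral_eq_integral) (auto intro: less_imp_le)

lemma gaussian_mixture_pos:
  assumes "prob_space P" "sets P = sets borel"
  shows "0 < gaussian_mixture P x"
proof -
  interpret prob_space P by fact
  have "(LINT z|P. 0) < gaussian_mixture P x"
    unfolding gaussian_mixture_def
    using integrable_std_gaussian_density_diff[OF assms]
    by (intro integral_less_AE_space) (auto simp: std_gaussian_density_pos emeasure_space_1)
  then show ?thesis by simp
qed

lemma borel_measurable_gaussian_mixture:
  assumes "prob_space P" "sets P = sets borel"
  shows "gaussian_mixture P \<in> borel_measurable borel"
proof -
  interpret prob_space P by fact
  have [measurable_cong]: "sets P = sets borel" by fact
  show ?thesis unfolding gaussian_mixture_def by measurable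
qed

lemma gaussian_mixture_is_density:
  assumes "prob_space P" "sets P = sets borel"
  shows "integrable lborel (gaussian_mixture P)"
    and "(LINT x|lborel. gaussian_mixture P x) = 1"
proof -
  interpret prob_space P by fact
  interpret pair_sigma_finite P lborel ..
  have [measurable_cong]: "sets P = sets borel" by fact
  have "(\<integral>\<^sup>+x. ennreal (gaussian_mixture P x) \<partial>lborel)
    = (\<integral>\<^sup>+x. \<integral>\<^sup>+z. ennreal (std_gaussian_density (x - z)) \<partial>P \<partial>lborel)"
    by (simp add: gaussian_mixture_eq_nn_integral assms)
  also have "\<dots> = (\<integral>\<^sup>+z. \<integral>\<^sup>+x. ennreal (std_gaussian_density (x - z)) \<partial>lborel \<partial>P)"
    by (rule Fubini') measurable
  also have "\<dots> = 1"
    by (simp add: nn_integral_std_gaussian_density emeasure_space_1)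
  finally have *: "(\<integral>\<^sup>+x. ennreal (gaussian_mixture P x) \<partial>lborel) = ennreal 1" by simp
  have "has_bochner_integral lborel (gaussian_mixture P) 1"
    using * borel_measurable_gaussian_mixture[OF assms] gaussian_mixture_pos[OF assms]
    by (intro has_bochner_integral_nn_integral) (auto intro: less_imp_le)
  then show "integrable lborel (gaussian_mixture P)"
    "(LINT x|lborel. gaussian_mixture P x) = 1"
    by (auto simp: has_bochner_integral_iff)
qed

section \<open>Chi-square divergence of two mixtures\<close>

text \<open>
  Joint convexity of \<open>(u, v) \<mapsto> u\<^sup>2 / v\<close> in the form of its supporting hyperplanes: the function is
  homogeneous of degree one, so its tangent plane along the ray \<open>u = t v\<close> is the linear function
  \<open>2 t u - t\<^sup>2 v\<close>.
\<close>

lemma square_quotient_above_tangent: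
  fixes u v t :: real
  assumes "0 < v"
  shows "2 * t * u \<le> u\<^sup>2 / v + t\<^sup>2 * v"
proof -
  have "0 \<le> (u - t * v)\<^sup>2 / v" using assms by simp
  also have "\<dots> = u\<^sup>2 / v + t\<^sup>2 * v - 2 * t * u"
    using assms by (simp add: power2_eq_square field_simps)
  finally show ?thesis by simp
qed

text \<open>
  Jensen's inequality for \<open>u\<^sup>2 / v\<close> under the product of the two mixing distributions: the tangent
  plane is taken at the slope \<open>t\<close> of the averages and integrated over \<open>a\<close> and \<open>b\<close>. The negative
  term is kept on the right, so that both sides are integrals of nonnegative functions and can be
  evaluated in the extended nonnegative reals.
\<close>

lemma gaussian_mixture_square_quotient_le:
  fixes P Q :: "(real ^ 'n) measure"
  assumes P: "prob_space P" "sets P = sets borel" and Q: "prob_space Q" "sets Q = sets borel"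
  shows "ennreal ((gaussian_mixture P x)\<^sup>2 / gaussian_mixture Q x) \<le>
    (\<integral>\<^sup>+a. \<integral>\<^sup>+b. ennreal ((std_gaussian_density (x - a))\<^sup>2 / std_gaussian_density (x - b)) \<partial>Q \<partial>P)"
    (is "ennreal ?c \<le> ?I")
proof -
  interpret P: prob_space P by fact
  interpret Q: prob_space Q by fact
  have [measurable_cong]: "sets P = sets borel" "sets Q = sets borel" by fact+
  let ?\<phi> = "std_gaussian_density :: real ^ 'n \<Rightarrow> real"
  define f g where "f = gaussian_mixture P x" and "g = gaussian_mixture Q x"
  have f: "0 < f" and g: "0 < g"
    using gaussian_mixture_pos P Q by (auto simp: f_def g_def)
  define t where "t = f / g"
  have t: "0 < t" using f g by (simp add: t_def)
  have \<phi>: "0 \<le> ?\<phi> z" for z by (simp add: std_gaussian_density_pos less_imp_le)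
  have "ennreal (2 * t * f) = (\<integral>\<^sup>+a. \<integral>\<^sup>+b. ennreal (2 * t * ?\<phi> (x - a)) \<partial>Q \<partial>P)"
    using t \<phi> by (simp add: f_def gaussian_mixture_eq_nn_integral P ennreal_mult' nn_integral_cmult Q.emeasure_space_1)
  also have "\<dots> \<le> (\<integral>\<^sup>+a. \<integral>\<^sup>+b. ennreal ((?\<phi> (x - a))\<^sup>2 / ?\<phi> (x - b)) + ennreal (t\<^sup>2 * ?\<phi> (x - b)) \<partial>Q \<partial>P)"
    using \<phi> square_quotient_above_tangent[OF std_gaussian_density_pos]
    by (intro nn_integral_mono) (auto simp flip: ennreal_plus intro!: ennreal_leI)
  also have "\<dots> = ?I + ennreal (t\<^sup>2 * g)"
    using t \<phi> by (simp add: nn_integral_add g_def gaussian_mixture_eq_nn_integral Q ennreal_mult' nn_integral_cmult P.emeasure_space_1)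
  finally have "ennreal (2 * t * f) \<le> ?I + ennreal (t\<^sup>2 * g)" .
  moreover have "2 * t * f = ?c + ?c" "t\<^sup>2 * g = ?c" "0 \<le> ?c"
    using f g by (auto simp: t_def power2_eq_square field_simps simp flip: f_def g_def)
  ultimately have "ennreal ?c + ennreal ?c \<le> ennreal ?c + ?I"
    by (simp only: ennreal_plus add.commute)
  then show ?thesis
    by (simp add: ennreal_add_left_cancel_le)
qed

text \<open>
  After Jensen's inequality, Tonelli's theorem moves the integral over \<open>x\<close> inside, where it is the
  explicit second moment for two single Gaussians. Two centres in the ball are at distance at most
  \<open>2 M\<close>.
\<close>

lemma gaussian_mixture_chi_square_le:
  fixes P Q :: "(real ^ 'n) measure"
  assumes P: "prob_dist_on (cball 0 M) P" and Q: "prob_dist_on (cball 0 M) Q"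
  defines "h \<equiv> \<lambda>x. (gaussian_mixture P x)\<^sup>2 / gaussian_mixture Q x"
  shows "integrable lborel h" and "(LINT x|lborel. h x) \<le> exp (4 * M\<^sup>2)"
proof -
  have P': "prob_space P" "sets P = sets borel" "AE z in P. norm z \<le> M"
    and Q': "prob_space Q" "sets Q = sets borel" "AE z in Q. norm z \<le> M"
    using P Q by (auto simp: prob_dist_on_def)
  interpret P: prob_space P by fact
  interpret Q: prob_space Q by fact
  interpret PL: pair_sigma_finite P lborel ..
  interpret QL: pair_sigma_finite Q lborel ..
  have [measurable_cong]: "sets P = sets borel" "sets Q = sets borel" by fact+
  let ?\<phi> = "std_gaussian_density :: real ^ 'n \<Rightarrow> real"
  have [measurable]: "h \<in> borel_measurable borel"
    unfolding h_def using borel_measurable_gaussian_mixture P'(1,2) Q'(1,2) by measurable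
  have h: "0 \<le> h x" for x
    using gaussian_mixture_pos[OF Q'(1,2), of x] by (simp add: h_def)
  have pair: "(\<integral>\<^sup>+x. ennreal ((?\<phi> (x - a))\<^sup>2 / ?\<phi> (x - b)) \<partial>lborel) = ennreal (exp ((norm (a - b))\<^sup>2))" 
    for a b :: "real ^ 'n"
    by (simp add: std_gaussian_density_square_quotient ennreal_mult' nn_integral_cmult
        nn_integral_std_gaussian_density)
  have "(\<integral>\<^sup>+x. ennreal (h x) \<partial>lborel)
    \<le> (\<integral>\<^sup>+x. \<integral>\<^sup>+a. \<integral>\<^sup>+b. ennreal ((?\<phi> (x - a))\<^sup>2 / ?\<phi> (x - b)) \<partial>Q \<partial>P \<partial>lborel)"
    unfolding h_def using P' Q' by (intro nn_integral_mono gaussian_mixture_square_quotient_le) auto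
  also have "\<dots> = (\<integral>\<^sup>+a. \<integral>\<^sup>+x. \<integral>\<^sup>+b. ennreal ((?\<phi> (x - a))\<^sup>2 / ?\<phi> (x - b)) \<partial>Q \<partial>lborel \<partial>P)"
    by (rule PL.Fubini') measurable
  also have "\<dots> = (\<integral>\<^sup>+a. \<integral>\<^sup>+b. \<integral>\<^sup>+x. ennreal ((?\<phi> (x - a))\<^sup>2 / ?\<phi> (x - b)) \<partial>lborel \<partial>Q \<partial>P)"
    by (intro nn_integral_cong QL.Fubini') measurable
  also have "\<dots> = (\<integral>\<^sup>+a. \<integral>\<^sup>+b. ennreal (exp ((norm (a - b))\<^sup>2)) \<partial>Q \<partial>P)"
    by (simp add: pair)
  also have "\<dots> \<le> (\<integral>\<^sup>+a. \<integral>\<^sup>+b. ennreal (exp (4 * M\<^sup>2)) \<partial>Q \<partial>P)"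
  proof (rule nn_integral_mono_AE, use P'(3) in eventually_elim)
    fix a :: "real ^ 'n" assume a: "norm a \<le> M"
    show "(\<integral>\<^sup>+b. ennreal (exp ((norm (a - b))\<^sup>2)) \<partial>Q) \<le> (\<integral>\<^sup>+b. ennreal (exp (4 * M\<^sup>2)) \<partial>Q)"
    proof (rule nn_integral_mono_AE, use Q'(3) in eventually_elim)
      fix b :: "real ^ 'n" assume "norm b \<le> M"
      then have "norm (a - b) \<le> 2 * M"
        using a norm_triangle_ineq4[of a b] by simp
      then have "(norm (a - b))\<^sup>2 \<le> (2 * M)\<^sup>2"
        by (intro power_mono) auto
      then show "ennreal (exp ((norm (a - b))\<^sup>2)) \<le> ennreal (exp (4 * M\<^sup>2))"
        by (simp add: power_mult_distrib)
    qed
  qed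
  also have "\<dots> = ennreal (exp (4 * M\<^sup>2))"
    by (simp add: P.emeasure_space_1 Q.emeasure_space_1)
  finally have bound: "(\<integral>\<^sup>+x. ennreal (h x) \<partial>lborel) \<le> ennreal (exp (4 * M\<^sup>2))" .
  show int: "integrable lborel h"
    using bound h by (intro integrableI_bounded) (auto simp: le_less_trans)
  then have "ennreal (LINT x|lborel. h x) \<le> ennreal (exp (4 * M\<^sup>2))"
    using bound h by (simp add: nn_integral_eq_integral)
  then show "(LINT x|lborel. h x) \<le> exp (4 * M\<^sup>2)" by simp
qed

section \<open>The comparison for Gaussian mixtures\<close>

theorem theorem3:
  fixes M :: real and \<pi> \<eta> :: "(real ^ 'n) measure"
  assumes "M \<ge> 1"
    and "prob_dist_on (cball 0 M) \<pi>"
    and "prob_dist_on (cball 0 M) \<eta>"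
  shows "let f = gaussian_mixture \<pi>; g = gaussian_mixture \<eta>; H2 = hellinger_sq f g in
    kl_integrable f g \<and>
    kl_density f g \<le> 200 * M\<^sup>2 * H2 + 16 * H2 * ln (1 / H2)"
proof -
  define f g where "f = gaussian_mixture \<pi>" and "g = gaussian_mixture \<eta>"
  define H where "H = hellinger_sq f g"
  have \<pi>: "prob_space \<pi>" "sets \<pi> = sets borel" and \<eta>: "prob_space \<eta>" "sets \<eta> = sets borel"
    using assms by (auto simp: prob_dist_on_def)
  have f: "integrable lborel f" "(LINT x|lborel. f x) = 1" "0 \<le> f x"
    and g: "integrable lborel g" "(LINT x|lborel. g x) = 1" "0 < g x" for x
    using gaussian_mixture_is_density[OF \<pi>] gaussian_mixture_is_density[OF \<eta>]
      gaussian_mixture_pos[OF \<pi>] gaussian_mixture_pos[OF \<eta>]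
    by (auto simp: f_def g_def intro: less_imp_le)
  have chi: "integrable lborel (\<lambda>x. (f x)\<^sup>2 / g x)" "(LINT x|lborel. (f x)\<^sup>2 / g x) \<le> exp (4 * M\<^sup>2)"
    using gaussian_mixture_chi_square_le[OF assms(2,3)] by (auto simp: f_def g_def)
  have M2: "1 \<le> M\<^sup>2" using assms(1) by simp
  have "kl_integrable f g"
    unfolding kl_integrable_def using f g chi by (intro kl_integrable_of_chi_square) auto
  moreover have "kl_density f g \<le> 5 * H * (4 * M\<^sup>2 + ln (1 / H))"
    unfolding kl_density_def H_def hellinger_sq_def
    using f g chi M2 by (intro kl_le_hellinger_of_chi_square_le) auto
  moreover have "5 * H * (4 * M\<^sup>2 + ln (1 / H)) \<le> 200 * M\<^sup>2 * H + 16 * H * ln (1 / H)"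
  proof (cases "H = 0")
    case False
    have "0 \<le> H" by (simp add: H_def hellinger_sq_def)
    with False have H: "0 < H" by simp
    have "H \<le> 2"
      using hellinger_integrable(2)[OF f(1) g(1) f(3) less_imp_le[OF g(3)]] f(2) g(2)
      by (simp add: H_def hellinger_sq_def)
    then have "ln H \<le> 1"
      using ln_le_minus_one[OF H] by simp
    then have "0 \<le> H * (180 * M\<^sup>2 + 11 * ln (1 / H))"
      using H M2 by (intro mult_nonneg_nonneg) (auto simp: ln_div)
    then show ?thesis by (simp add: algebra_simps)
  qed simp
  ultimately show ?thesis
    by (simp add: Let_def H_def flip: f_def g_def)
qed

end
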